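(* Let $n\ge 1$, let $V$ be the vector space with basis $(x_0,x_1,\ldots,x_n)$, let $1\le i\le n$, and let $f_i:V\to V$ be the linear map with $f_i(x_j)=\delta_{i,j}x_0$ for $0\le j\le n$. Grade $V$ by letting $x_1,\ldots,x_n$ be homogeneous of degree $1$ and $x_0$ homogeneous of degree $2$, so that $f_i$ is homogeneous of degree $1$. Then $T(V,f_i)$ inherits a gradation of pre-Lie algebra $T(V,f_i)=\bigoplus_{k\ge 0}T(V,f_i)_k$, where a word in $x_0,\ldots,x_n$ is homogeneous of degree $1$ plus the sum of the degrees of its letters, and the formal series of this gradation is $$\sum_{k\ge 0}\dim(T(V,f_i)_k)X^k=\frac{X}{1-nX-X^2}=\sum_{k\ge 0}\frac{1}{\sqrt{n^2+4}}\left(\left(\frac{n+\sqrt{n^2+4}}{2}\right)^k-\left(\frac{n-\sqrt{n^2+4}}{2}\right)^k\right)X^k.$$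
   Context: $\mathbb{K}$ is a field of characteristic zero. For a vector space $V$, $T(V)=\bigoplus_{n\ge 0}V^{\otimes n}$ is spanned by words with letters in $V$; $\emptyset$ is the empty word; juxtaposition is concatenation. The shuffle product $\sqcup\!\sqcup$ is the bilinear product with unit $\emptyset$ and $xu\sqcup\!\sqcup yv=x(u\sqcup\!\sqcup yv)+y(xu\sqcup\!\sqcup v)$ for $x,y\in V$, $u,v\in T(V)$. For a linear endomorphism $f$ of $V$, the bilinear product $\bullet$ on $T(V)$ is defined by $\emptyset\bullet w'=0$ and $(xw)\bullet w'=x(w\bullet w')+f(x)(w\sqcup\!\sqcup w')$ for $x\in V$, $w,w'\in T(V)$. It is right pre-Lie, and $T(V,f)$ denotes $T(V)$ with this product. A gradation $(A_k)_{k\ge 0}$ of a pre-Lie algebra $A$ is a decomposition $A=\bigoplus_k A_k$ with $A_k\bullet A_l\subseteq A_{k+l}$. *)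

theory Defs
  imports
    Complex_Main
    "HOL-Library.Poly_Mapping"
    "HOL-Computational_Algebra.Formal_Power_Series"
begin

text \<open>
  The type \<open>'b \<Rightarrow>\<^sub>0 'k\<close> is the vector space over \<open>'k\<close> with basis \<open>(basis b)\<close> indexed by \<open>'b\<close>.
  Vectors are elements of \<open>'x \<Rightarrow>\<^sub>0 'k\<close>; tensors over this space are elements of
  \<open>'x list \<Rightarrow>\<^sub>0 'k\<close>, since the words in the basis letters form a basis of the tensor algebra.
\<close>

definition fscale :: "'k::field \<Rightarrow> ('b \<Rightarrow>\<^sub>0 'k) \<Rightarrow> ('b \<Rightarrow>\<^sub>0 'k)"
  where "fscale c p = Poly_Mapping.map ((*) c) p"

definition basis :: "'b \<Rightarrow> ('b \<Rightarrow>\<^sub>0 'k::field)"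
  where "basis b = Poly_Mapping.single b 1"

lemma lookup_fscale [simp]: "Poly_Mapping.lookup (fscale c p) b = c * Poly_Mapping.lookup p b"
  by (simp add: fscale_def map.rep_eq when_def)

interpretation fvs: vector_space "fscale :: 'k::field \<Rightarrow> ('b \<Rightarrow>\<^sub>0 'k) \<Rightarrow> ('b \<Rightarrow>\<^sub>0 'k)"
  by unfold_locales (auto intro!: poly_mapping_eqI simp: lookup_add algebra_simps)

interpretation fvs_pair: vector_space_pair
  "fscale :: 'k::field \<Rightarrow> ('b \<Rightarrow>\<^sub>0 'k) \<Rightarrow> ('b \<Rightarrow>\<^sub>0 'k)"
  "fscale :: 'k \<Rightarrow> ('c \<Rightarrow>\<^sub>0 'k) \<Rightarrow> ('c \<Rightarrow>\<^sub>0 'k)"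
  by unfold_locales

definition lin_ext :: "('b \<Rightarrow> ('c \<Rightarrow>\<^sub>0 'k::field)) \<Rightarrow> ('b \<Rightarrow>\<^sub>0 'k) \<Rightarrow> ('c \<Rightarrow>\<^sub>0 'k)"
  where "lin_ext g p = (\<Sum>b\<in>Poly_Mapping.keys p. fscale (Poly_Mapping.lookup p b) (g b))"

lemma lin_ext_superset:
  assumes "finite S" "Poly_Mapping.keys p \<subseteq> S"
  shows "lin_ext g p = (\<Sum>b\<in>S. fscale (Poly_Mapping.lookup p b) (g b))"
  unfolding lin_ext_def
  by (rule sum.mono_neutral_left) (use assms in \<open>auto simp: in_keys_iff\<close>)

lemma lin_ext_add: "lin_ext g (p + q) = lin_ext g p + lin_ext g q"
proof -
  let ?S = "Poly_Mapping.keys p \<union> Poly_Mapping.keys q"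
  have "lin_ext g (p + q) = (\<Sum>b\<in>?S. fscale (Poly_Mapping.lookup (p + q) b) (g b))"
    by (rule lin_ext_superset) (auto simp: keys_add)
  also have "\<dots> = (\<Sum>b\<in>?S. fscale (Poly_Mapping.lookup p b) (g b)) + (\<Sum>b\<in>?S. fscale (Poly_Mapping.lookup q b) (g b))"
    by (simp add: lookup_add fvs.scale_left_distrib sum.distrib)
  also have "\<dots> = lin_ext g p + lin_ext g q"
    by (simp add: lin_ext_superset[of ?S])
  finally show ?thesis .
qed

lemma lin_ext_scale: "lin_ext g (fscale c p) = fscale c (lin_ext g p)"
proof -
  have "lin_ext g (fscale c p) = (\<Sum>b\<in>Poly_Mapping.keys p. fscale (Poly_Mapping.lookup (fscale c p) b) (g b))"
    by (rule lin_ext_superset) (auto simp: in_keys_iff)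
  then show ?thesis
    by (simp add: lin_ext_def fvs.scale_sum_right)
qed

lemma fvs_linearI:
  assumes "\<And>p q. f (p + q) = f p + f q" "\<And>c p. f (fscale c p) = fscale c (f p)"
  shows "Vector_Spaces.linear fscale fscale f"
  by unfold_locales (fact assms)+

lemma linear_lin_ext: "Vector_Spaces.linear fscale fscale (lin_ext g)"
  by (rule fvs_linearI) (rule lin_ext_add lin_ext_scale)+

lemma lin_ext_basis [simp]: "lin_ext g (basis b) = g b"
  by (simp add: lin_ext_def basis_def)

lemma lin_ext_fun_add: "lin_ext (\<lambda>b. g b + h b) p = lin_ext g p + lin_ext h p"
  by (simp add: lin_ext_def fvs.scale_right_distrib sum.distrib)

lemma lin_ext_fun_scale: "lin_ext (\<lambda>b. fscale c (g b)) p = fscale c (lin_ext g p)"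
  by (simp add: lin_ext_def fvs.scale_sum_right mult.commute)

lemma lin_ext_fun_zero [simp]: "lin_ext (\<lambda>b. 0) p = 0"
  by (simp add: lin_ext_def)

lemma lin_ext_basis_id: "lin_ext basis p = p"
proof (rule poly_mapping_eqI)
  fix k
  have "Poly_Mapping.lookup (lin_ext basis p) k = (\<Sum>b\<in>Poly_Mapping.keys p. Poly_Mapping.lookup p b * (1 when b = k))"
    by (simp add: lin_ext_def lookup_sum basis_def lookup_single)
  also have "\<dots> = Poly_Mapping.lookup p k"
    by (simp add: when_def if_distrib in_keys_iff cong: if_cong)
  finally show "Poly_Mapping.lookup (lin_ext basis p) k = Poly_Mapping.lookup p k" .
qed

lemma span_range_basis: "fvs.span (range basis) = (UNIV :: ('b \<Rightarrow>\<^sub>0 'k::field) set)"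
proof -
  have "p \<in> fvs.span (range basis)" for p :: "'b \<Rightarrow>\<^sub>0 'k"
    by (subst lin_ext_basis_id[symmetric], unfold lin_ext_def)
      (intro fvs.span_sum fvs.span_scale fvs.span_base, simp)
  then show ?thesis by blast
qed

lemma linear_eq_on_basis:
  assumes "Vector_Spaces.linear fscale fscale f" "Vector_Spaces.linear fscale fscale g"
    and "\<And>b. f (basis b) = g (basis b)"
  shows "f p = g p"
  by (rule fvs_pair.linear_eq_on[OF assms(1,2), of _ "range basis"])
    (auto simp: span_range_basis assms(3))

text \<open>\<open>tcons v t\<close> is the concatenation \<open>v t\<close> in the tensor algebra, for any vector \<open>v\<close>.\<close>

definition tcons :: "('x \<Rightarrow>\<^sub>0 'k::field) \<Rightarrow> ('x list \<Rightarrow>\<^sub>0 'k) \<Rightarrow> ('x list \<Rightarrow>\<^sub>0 'k)"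
  where "tcons v t = lin_ext (\<lambda>x. lin_ext (\<lambda>w. basis (x # w)) t) v"

text \<open>
  Both products are defined by recursion on words in basis letters and extended bilinearly.
  The recursive equations for arbitrary vectors as letters are the lemmas
  \<open>shuffle_tcons\<close> and \<open>bullet_tcons\<close> below.
\<close>

fun shuffle_words :: "'x list \<Rightarrow> 'x list \<Rightarrow> ('x list \<Rightarrow>\<^sub>0 'k::field)"
  where
    "shuffle_words [] v = basis v"
  | "shuffle_words u [] = basis u"
  | "shuffle_words (x # u) (y # v) =
       tcons (basis x) (shuffle_words u (y # v)) + tcons (basis y) (shuffle_words (x # u) v)"

definition shuffle :: "('x list \<Rightarrow>\<^sub>0 'k::field) \<Rightarrow> ('x list \<Rightarrow>\<^sub>0 'k) \<Rightarrow> ('x list \<Rightarrow>\<^sub>0 'k)"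
  where "shuffle p q = lin_ext (\<lambda>u. lin_ext (shuffle_words u) q) p"

primrec bullet_words ::
  "(('x \<Rightarrow>\<^sub>0 'k::field) \<Rightarrow> ('x \<Rightarrow>\<^sub>0 'k)) \<Rightarrow> 'x list \<Rightarrow> 'x list \<Rightarrow> ('x list \<Rightarrow>\<^sub>0 'k)"
  where
    "bullet_words f [] w' = 0"
  | "bullet_words f (x # w) w' =
       tcons (basis x) (bullet_words f w w') + tcons (f (basis x)) (shuffle_words w w')"

definition bullet ::
  "(('x \<Rightarrow>\<^sub>0 'k::field) \<Rightarrow> ('x \<Rightarrow>\<^sub>0 'k)) \<Rightarrow>
   ('x list \<Rightarrow>\<^sub>0 'k) \<Rightarrow> ('x list \<Rightarrow>\<^sub>0 'k) \<Rightarrow> ('x list \<Rightarrow>\<^sub>0 'k)"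
  where "bullet f p q = lin_ext (\<lambda>u. lin_ext (bullet_words f u) q) p"

lemma tcons_add_left: "tcons (v + v') t = tcons v t + tcons v' t"
  and tcons_scale_left: "tcons (fscale c v) t = fscale c (tcons v t)"
  and tcons_add_right: "tcons v (t + t') = tcons v t + tcons v t'"
  and tcons_scale_right: "tcons v (fscale c t) = fscale c (tcons v t)"
  and tcons_basis: "tcons (basis x) (basis w) = basis (x # w)"
  by (simp_all add: tcons_def lin_ext_add lin_ext_scale lin_ext_fun_add lin_ext_fun_scale)

lemma shuffle_add_left: "shuffle (p + p') q = shuffle p q + shuffle p' q"
  and shuffle_scale_left: "shuffle (fscale c p) q = fscale c (shuffle p q)"
  and shuffle_add_right: "shuffle p (q + q') = shuffle p q + shuffle p q'"
  and shuffle_scale_right: "shuffle p (fscale c q) = fscale c (shuffle p q)"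
  and shuffle_basis: "shuffle (basis u) (basis v) = shuffle_words u v"
  by (simp_all add: shuffle_def lin_ext_add lin_ext_scale lin_ext_fun_add lin_ext_fun_scale)

lemma bullet_add_left: "bullet f (p + p') q = bullet f p q + bullet f p' q"
  and bullet_scale_left: "bullet f (fscale c p) q = fscale c (bullet f p q)"
  and bullet_add_right: "bullet f p (q + q') = bullet f p q + bullet f p q'"
  and bullet_scale_right: "bullet f p (fscale c q) = fscale c (bullet f p q)"
  and bullet_basis: "bullet f (basis u) (basis v) = bullet_words f u v"
  by (simp_all add: bullet_def lin_ext_add lin_ext_scale lin_ext_fun_add lin_ext_fun_scale)

lemmas bilinear_simps =
  tcons_add_left tcons_scale_left tcons_add_right tcons_scale_right
  shuffle_add_left shuffle_scale_left shuffle_add_right shuffle_scale_right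
  bullet_add_left bullet_scale_left bullet_add_right bullet_scale_right

lemma shuffle_empty_left: "shuffle (basis []) p = p"
proof -
  have "shuffle_words [] = (basis :: 'a list \<Rightarrow> 'a list \<Rightarrow>\<^sub>0 'b)"
    by (rule ext) simp
  then show ?thesis by (simp add: shuffle_def lin_ext_basis_id)
qed

lemma shuffle_empty_right: "shuffle p (basis []) = p"
proof -
  have "shuffle_words u [] = (basis u :: 'a list \<Rightarrow>\<^sub>0 'b)" for u
    by (cases u) simp_all
  then show ?thesis by (simp add: shuffle_def lin_ext_basis_id)
qed

lemma shuffle_tcons:
  "shuffle (tcons x u) (tcons y v) = tcons x (shuffle u (tcons y v)) + tcons y (shuffle (tcons x u) v)"
proof -
  have 1: "shuffle (tcons (basis a) (basis s)) (tcons (basis b) (basis t)) =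
      tcons (basis a) (shuffle (basis s) (tcons (basis b) (basis t))) +
      tcons (basis b) (shuffle (tcons (basis a) (basis s)) (basis t))" for a s b t
    by (simp add: tcons_basis shuffle_basis)
  have 2: "shuffle (tcons (basis a) (basis s)) (tcons (basis b) v) =
      tcons (basis a) (shuffle (basis s) (tcons (basis b) v)) +
      tcons (basis b) (shuffle (tcons (basis a) (basis s)) v)" for a s b
    by (rule linear_eq_on_basis[of _ _ v]; (intro fvs_linearI)?)
      (simp_all only: 1 bilinear_simps fvs.scale_right_distrib ac_simps)
  have 3: "shuffle (tcons (basis a) (basis s)) (tcons y v) =
      tcons (basis a) (shuffle (basis s) (tcons y v)) +
      tcons y (shuffle (tcons (basis a) (basis s)) v)" for a s
    by (rule linear_eq_on_basis[of _ _ y]; (intro fvs_linearI)?)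
      (simp_all only: 2 bilinear_simps fvs.scale_right_distrib ac_simps)
  have 4: "shuffle (tcons (basis a) u) (tcons y v) =
      tcons (basis a) (shuffle u (tcons y v)) + tcons y (shuffle (tcons (basis a) u) v)" for a
    by (rule linear_eq_on_basis[of _ _ u]; (intro fvs_linearI)?)
      (simp_all only: 3 bilinear_simps fvs.scale_right_distrib ac_simps)
  show ?thesis
    by (rule linear_eq_on_basis[of _ _ x]; (intro fvs_linearI)?)
      (simp_all only: 4 bilinear_simps fvs.scale_right_distrib ac_simps)
qed

lemma bullet_empty: "bullet f (basis []) w' = 0"
proof -
  have "bullet_words f [] = (\<lambda>_. 0)"
    by (rule ext) simp
  then show ?thesis by (simp add: bullet_def)
qed

lemma bullet_tcons:
  assumes "Vector_Spaces.linear fscale fscale f"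
  shows "bullet f (tcons x w) w' = tcons x (bullet f w w') + tcons (f x) (shuffle w w')"
proof -
  interpret f: Vector_Spaces.linear fscale fscale f by fact
  note simps = bilinear_simps fvs.scale_right_distrib ac_simps f.add f.scale
  have 1: "bullet f (tcons (basis a) (basis s)) (basis t) =
      tcons (basis a) (bullet f (basis s) (basis t)) +
      tcons (f (basis a)) (shuffle (basis s) (basis t))" for a s t
    by (simp add: tcons_basis shuffle_basis bullet_basis)
  have 2: "bullet f (tcons (basis a) (basis s)) w' =
      tcons (basis a) (bullet f (basis s) w') + tcons (f (basis a)) (shuffle (basis s) w')" for a s
    by (rule linear_eq_on_basis[of _ _ w']; (intro fvs_linearI)?) (simp_all only: 1 simps)
  have 3: "bullet f (tcons (basis a) w) w' =
      tcons (basis a) (bullet f w w') + tcons (f (basis a)) (shuffle w w')" for a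
    by (rule linear_eq_on_basis[of _ _ w]; (intro fvs_linearI)?) (simp_all only: 2 simps)
  show ?thesis
    by (rule linear_eq_on_basis[of _ _ x]; (intro fvs_linearI)?) (simp_all only: 3 simps)
qed

text \<open>The carrier is a subspace \<open>A\<close>; values of the product outside \<open>A\<close> play no role.\<close>

locale right_pre_lie_algebra = vector_space scale
  for scale :: "'k::field \<Rightarrow> 'v::ab_group_add \<Rightarrow> 'v" +
  fixes A :: "'v set" and pl :: "'v \<Rightarrow> 'v \<Rightarrow> 'v"
  assumes subspace_carrier: "subspace A"
    and closed: "\<lbrakk>a \<in> A; b \<in> A\<rbrakk> \<Longrightarrow> pl a b \<in> A"
    and add_left: "\<lbrakk>a \<in> A; b \<in> A; c \<in> A\<rbrakk> \<Longrightarrow> pl (a + b) c = pl a c + pl b c"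
    and add_right: "\<lbrakk>a \<in> A; b \<in> A; c \<in> A\<rbrakk> \<Longrightarrow> pl a (b + c) = pl a b + pl a c"
    and scaling_left: "\<lbrakk>a \<in> A; b \<in> A\<rbrakk> \<Longrightarrow> pl (scale r a) b = scale r (pl a b)"
    and scaling_right: "\<lbrakk>a \<in> A; b \<in> A\<rbrakk> \<Longrightarrow> pl a (scale r b) = scale r (pl a b)"
    and right_pre_lie: "\<lbrakk>a \<in> A; b \<in> A; c \<in> A\<rbrakk> \<Longrightarrow>
          pl (pl a b) c - pl a (pl b c) = pl (pl a c) b - pl a (pl c b)"

locale graded_right_pre_lie_algebra = right_pre_lie_algebra +
  fixes G :: "nat \<Rightarrow> 'b set"
  assumes subspace_component: "subspace (G k)"
    and component_subset: "G k \<subseteq> A"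
    and direct_sum: "a \<in> A \<Longrightarrow>
          \<exists>!g. (\<forall>k. g k \<in> G k) \<and> finite {k. g k \<noteq> 0} \<and> a = (\<Sum>k | g k \<noteq> 0. g k)"
    and graded: "\<lbrakk>a \<in> G k; b \<in> G l\<rbrakk> \<Longrightarrow> pl a b \<in> G (k + l)"

definition letter_degree :: "nat \<Rightarrow> nat"
  where "letter_degree j = (if j = 0 then 2 else 1)"

definition word_degree :: "nat list \<Rightarrow> nat"
  where "word_degree w = 1 + (\<Sum>j\<leftarrow>w. letter_degree j)"

definition V :: "nat \<Rightarrow> (nat \<Rightarrow>\<^sub>0 'k::field) set"
  where "V n = fvs.span (basis ` {0..n})"

definition V_component :: "nat \<Rightarrow> nat \<Rightarrow> (nat \<Rightarrow>\<^sub>0 'k::field) set"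
  where "V_component n d = fvs.span (basis ` {j \<in> {0..n}. letter_degree j = d})"

text \<open>Lists over \<open>{0..n}\<close> are the words in the letters \<open>x\<^sub>0, \<dots>, x\<^sub>n\<close>.\<close>

definition T :: "nat \<Rightarrow> (nat list \<Rightarrow>\<^sub>0 'k::field) set"
  where "T n = fvs.span (basis ` lists {0..n})"

definition T_component :: "nat \<Rightarrow> nat \<Rightarrow> (nat list \<Rightarrow>\<^sub>0 'k::field) set"
  where "T_component n k = fvs.span (basis ` {w \<in> lists {0..n}. word_degree w = k})"

end

theory Submission
  imports Defs
begin

text \<open>
  Two independent facts make up the theorem: the product is right pre-Lie and homogeneous, and the
  number of words of each degree satisfies a Fibonacci-like recurrence.

  The pre-Lie identity holds for every linear map \<open>f\<close>. The shuffle product is associative and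
  commutative, from which it follows by induction on words that \<open>p \<mapsto> p \<bullet> c\<close> is a derivation of the
  shuffle product (\<open>bullet_shuffle\<close>). Expanding the associator of \<open>x w\<close>, \<open>b\<close>, \<open>c\<close> with this
  Leibniz rule leaves only terms symmetric in \<open>b\<close> and \<open>c\<close> (\<open>bullet_right_pre_lie\<close>).

  For the gradation, all spaces involved are spanned by basis words, so the homogeneous components
  of a vector are read off from its coefficients (\<open>span_basis_direct_sum\<close>). A term of a product of
  two words has the letters of both, except that one letter of the first word has been replaced by
  a value of \<open>f\<close>, which raises the degree by one. As the degree of a word is one more than the
  sum of the degrees of its letters, the degrees add up (\<open>bullet_words_degree\<close>).

  The dimension of a component is the number of words of that degree. Removing the first letter of
  a word, which is \<open>0\<close> with degree two or one of the \<open>n\<close> letters of degree one, gives the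
  recurrence \<open>a (k + 2) = n a (k + 1) + a k\<close> with \<open>a 0 = 0\<close> and \<open>a 1 = 1\<close>
  (\<open>card_words_of_degree_rec\<close>). The generating function of a sequence is the stated fraction as
  soon as the sequence satisfies this recurrence with these initial values
  (\<open>fps_of_linear_recurrence\<close>), and the closed formula satisfies it as well (\<open>fps_binet\<close>).
\<close>

section \<open>The shuffle algebra\<close>

lemma shuffle_zero_left [simp]: "shuffle 0 q = 0"
  and shuffle_zero_right [simp]: "shuffle p 0 = 0"
  by (simp_all add: shuffle_def lin_ext_def)

lemma shuffle_words_commute: "shuffle_words u v = shuffle_words v u"
proof (induction u v rule: shuffle_words.induct)
  case (1 v)
  then show ?case by (cases v) simp_all
qed (simp_all add: ac_simps)

lemma shuffle_commute: "shuffle p q = shuffle q p"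
proof -
  have 1: "shuffle (basis u) q = shuffle q (basis u)" for u
    by (rule linear_eq_on_basis[of _ _ q]; (intro fvs_linearI)?)
      (simp_all add: bilinear_simps shuffle_basis shuffle_words_commute)
  show ?thesis
    by (rule linear_eq_on_basis[of _ _ p]; (intro fvs_linearI)?)
      (simp_all add: bilinear_simps 1)
qed

lemma shuffle_assoc_basis:
  "shuffle (shuffle (basis u) (basis v)) (basis w) =
    shuffle (basis u) (shuffle (basis v) (basis w) :: 'x list \<Rightarrow>\<^sub>0 'k::field)"
proof (induction "length u + length v + length w" arbitrary: u v w rule: less_induct)
  case less
  show ?case
  proof (cases "u = [] \<or> v = [] \<or> w = []")
    case True
    then show ?thesis by (auto simp: shuffle_empty_left shuffle_empty_right)
  next
    case False
    then obtain x u' y v' z w' where eq: "u = x # u'" "v = y # v'" "w = z # w'"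
      by (meson neq_Nil_conv)
    let ?u = "basis u :: 'x list \<Rightarrow>\<^sub>0 'k" and ?u' = "basis u' :: 'x list \<Rightarrow>\<^sub>0 'k"
    let ?v = "basis v :: 'x list \<Rightarrow>\<^sub>0 'k" and ?v' = "basis v' :: 'x list \<Rightarrow>\<^sub>0 'k"
    let ?w = "basis w :: 'x list \<Rightarrow>\<^sub>0 'k" and ?w' = "basis w' :: 'x list \<Rightarrow>\<^sub>0 'k"
    have cons: "?u = tcons (basis x) ?u'" "?v = tcons (basis y) ?v'" "?w = tcons (basis z) ?w'"
      by (simp_all add: eq tcons_basis)
    have "shuffle (shuffle ?u ?v) ?w = tcons (basis x) (shuffle (shuffle ?u' ?v) ?w) +
        tcons (basis y) (shuffle (shuffle ?u ?v') ?w) + tcons (basis z) (shuffle (shuffle ?u ?v) ?w')"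
      unfolding cons by (simp add: shuffle_tcons bilinear_simps ac_simps)
    also have "\<dots> = tcons (basis x) (shuffle ?u' (shuffle ?v ?w)) +
        tcons (basis y) (shuffle ?u (shuffle ?v' ?w)) + tcons (basis z) (shuffle ?u (shuffle ?v ?w'))"
      using less[of u' v w] less[of u v' w] less[of u v w'] by (simp add: eq)
    also have "\<dots> = shuffle ?u (shuffle ?v ?w)"
      unfolding cons by (simp add: shuffle_tcons bilinear_simps ac_simps)
    finally show ?thesis .
  qed
qed

lemma shuffle_assoc: "shuffle (shuffle p q) r = shuffle p (shuffle q r)"
proof -
  have 1: "shuffle (shuffle (basis u) (basis v)) r = shuffle (basis u) (shuffle (basis v) r)" for u v
    by (rule linear_eq_on_basis[of _ _ r]; (intro fvs_linearI)?)
      (simp_all add: bilinear_simps shuffle_assoc_basis)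
  have 2: "shuffle (shuffle (basis u) q) r = shuffle (basis u) (shuffle q r)" for u
    by (rule linear_eq_on_basis[of _ _ q]; (intro fvs_linearI)?)
      (simp_all add: bilinear_simps 1)
  show ?thesis
    by (rule linear_eq_on_basis[of _ _ p]; (intro fvs_linearI)?)
      (simp_all add: bilinear_simps 2)
qed

section \<open>The pre-Lie identity\<close>

lemma bullet_zero_left [simp]: "bullet f 0 q = 0"
  by (simp add: bullet_def lin_ext_def)

text \<open>
  Let \<open>x\<close> and \<open>y\<close> be the first letters of the two words. After expansion of both sides, the terms
  that start with \<open>f x\<close> and \<open>f y\<close> match because the shuffle product is associative and
  commutative, and those that start with \<open>x\<close> and \<open>y\<close> match by the induction hypotheses.
\<close>

lemma bullet_shuffle_basis:
  fixes f :: "('x \<Rightarrow>\<^sub>0 'k::field) \<Rightarrow> ('x \<Rightarrow>\<^sub>0 'k)"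
  assumes f: "Vector_Spaces.linear fscale fscale f"
  shows "bullet f (shuffle (basis u) (basis v)) c =
    shuffle (bullet f (basis u) c) (basis v) + shuffle (basis u) (bullet f (basis v) c)"
proof (induction "length u + length v" arbitrary: u v rule: less_induct)
  case less
  show ?case
  proof (cases "u = [] \<or> v = []")
    case True
    then show ?thesis by (auto simp: shuffle_empty_left shuffle_empty_right bullet_empty)
  next
    case False
    then obtain x u' y v' where eq: "u = x # u'" "v = y # v'"
      by (meson neq_Nil_conv)
    have IH1: "bullet f (shuffle (basis u') (basis v)) c =
        shuffle (bullet f (basis u') c) (basis v) + shuffle (basis u') (bullet f (basis v) c)"
      and IH2: "bullet f (shuffle (basis u) (basis v')) c =
        shuffle (bullet f (basis u) c) (basis v') + shuffle (basis u) (bullet f (basis v') c)"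
      using less[of u' v] less[of u v'] by (simp_all add: eq)
    have u: "basis u = (tcons (basis x) (basis u') :: 'x list \<Rightarrow>\<^sub>0 'k)"
      and v: "basis v = (tcons (basis y) (basis v') :: 'x list \<Rightarrow>\<^sub>0 'k)"
      by (simp_all add: eq tcons_basis)
    show ?thesis
      using IH1 IH2 unfolding u v
      by (simp add: shuffle_tcons bullet_tcons[OF f] bilinear_simps shuffle_assoc
          shuffle_commute[of c] ac_simps)
  qed
qed

text \<open>
  The Leibniz rule: the compatibility of both products that defines Com-Pre-Lie algebras.
\<close>

lemma bullet_shuffle:
  assumes f: "Vector_Spaces.linear fscale fscale f"
  shows "bullet f (shuffle p q) c = shuffle (bullet f p c) q + shuffle p (bullet f q c)"
proof -
  have 1: "bullet f (shuffle (basis u) q) c =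
      shuffle (bullet f (basis u) c) q + shuffle (basis u) (bullet f q c)" for u
    by (rule linear_eq_on_basis[of _ _ q]; (intro fvs_linearI)?)
      (simp_all add: bilinear_simps fvs.scale_right_distrib ac_simps bullet_shuffle_basis[OF f])
  show ?thesis
    by (rule linear_eq_on_basis[of _ _ p]; (intro fvs_linearI)?)
      (simp_all add: bilinear_simps fvs.scale_right_distrib ac_simps 1)
qed

text \<open>
  By the Leibniz rule the associator of \<open>x w\<close>, \<open>b\<close>, \<open>c\<close> is \<open>x\<close> followed by the associator of
  \<open>w\<close>, \<open>b\<close>, \<open>c\<close>, plus \<open>f x\<close> followed by the sum of the shuffle products of \<open>w \<bullet> b\<close> with \<open>c\<close> and of
  \<open>w \<bullet> c\<close> with \<open>b\<close>, plus \<open>f (f x)\<close> followed by the shuffle product of \<open>w\<close>, \<open>b\<close>, \<open>c\<close>. Each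
  summand is symmetric in \<open>b\<close> and \<open>c\<close>, the first one by induction.
\<close>

lemma bullet_right_pre_lie:
  fixes f :: "('x \<Rightarrow>\<^sub>0 'k::field) \<Rightarrow> ('x \<Rightarrow>\<^sub>0 'k)"
  assumes f: "Vector_Spaces.linear fscale fscale f"
  shows "bullet f (bullet f p b) c - bullet f p (bullet f b c) =
    bullet f (bullet f p c) b - bullet f p (bullet f c b)"
proof -
  \<comment> \<open>The differences are cleared, so that both sides expand to sums that agree up to reordering.\<close>
  have words: "bullet f (bullet f (basis u) b) c + bullet f (basis u) (bullet f c b) =
      bullet f (bullet f (basis u) c) b + bullet f (basis u) (bullet f b c)" for u
  proof (induction u)
    case Nil
    then show ?case by (simp add: bullet_empty)
  next
    case (Cons x u)
    have u: "basis (x # u) = (tcons (basis x) (basis u) :: 'x list \<Rightarrow>\<^sub>0 'k)"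
      by (simp add: tcons_basis)
    have "tcons (basis x) (bullet f (bullet f (basis u) b) c + bullet f (basis u) (bullet f c b)) =
        tcons (basis x) (bullet f (bullet f (basis u) c) b + bullet f (basis u) (bullet f b c))"
      by (simp only: Cons)
    then show ?case
      unfolding u
      by (simp add: bullet_tcons[OF f] bullet_shuffle[OF f] bilinear_simps shuffle_assoc
          shuffle_commute[of c b] ac_simps)
  qed
  have "bullet f (bullet f p b) c + bullet f p (bullet f c b) =
      bullet f (bullet f p c) b + bullet f p (bullet f b c)"
    by (rule linear_eq_on_basis[of _ _ p]; (intro fvs_linearI)?; (rule words)?)
      (simp_all add: bilinear_simps fvs.scale_right_distrib ac_simps)
  then show ?thesis by (simp add: algebra_simps)
qed

section \<open>Subspaces spanned by basis vectors\<close>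

lemma span_basis_eq: "fvs.span (basis ` S) = {p :: 'b \<Rightarrow>\<^sub>0 'k::field. Poly_Mapping.keys p \<subseteq> S}"
proof
  have "Poly_Mapping.keys p \<subseteq> S \<longleftrightarrow> (\<forall>b. b \<notin> S \<longrightarrow> Poly_Mapping.lookup p b = 0)" for p :: "'b \<Rightarrow>\<^sub>0 'k"
    by (auto simp: in_keys_iff)
  then have "fvs.subspace {p :: 'b \<Rightarrow>\<^sub>0 'k. Poly_Mapping.keys p \<subseteq> S}"
    unfolding fvs.subspace_def by (simp add: lookup_add)
  then show "fvs.span (basis ` S) \<subseteq> {p :: 'b \<Rightarrow>\<^sub>0 'k. Poly_Mapping.keys p \<subseteq> S}"
    by (rule fvs.span_minimal[rotated]) (auto simp: basis_def)
  show "{p :: 'b \<Rightarrow>\<^sub>0 'k. Poly_Mapping.keys p \<subseteq> S} \<subseteq> fvs.span (basis ` S)"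
  proof safe
    fix p :: "'b \<Rightarrow>\<^sub>0 'k"
    assume "Poly_Mapping.keys p \<subseteq> S"
    then show "p \<in> fvs.span (basis ` S)"
      by (subst lin_ext_basis_id[symmetric], unfold lin_ext_def)
        (intro fvs.span_sum fvs.span_scale fvs.span_base, blast)
  qed
qed

lemma lin_ext_in_subspace:
  assumes "fvs.subspace W" "p \<in> fvs.span (basis ` S)" "\<And>b. b \<in> S \<Longrightarrow> g b \<in> W"
  shows "lin_ext g p \<in> W"
  unfolding lin_ext_def
proof (rule fvs.subspace_sum[OF assms(1)])
  fix b
  assume "b \<in> Poly_Mapping.keys p"
  then have "b \<in> S"
    using assms(2) by (auto simp: span_basis_eq)
  then show "fscale (Poly_Mapping.lookup p b) (g b) \<in> W"
    by (intro fvs.subspace_scale[OF assms(1)] assms(3))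
qed

lemma inj_basis: "inj (basis :: 'b \<Rightarrow> ('b \<Rightarrow>\<^sub>0 'k::field))"
proof (rule injI)
  fix x y :: 'b
  assume "basis x = (basis y :: 'b \<Rightarrow>\<^sub>0 'k)"
  then have "Poly_Mapping.keys (basis x :: 'b \<Rightarrow>\<^sub>0 'k) = Poly_Mapping.keys (basis y :: 'b \<Rightarrow>\<^sub>0 'k)"
    by (rule arg_cong)
  then show "x = y" by (simp add: basis_def)
qed

lemma independent_basis: "fvs.independent (basis ` S :: ('b \<Rightarrow>\<^sub>0 'k::field) set)"
  unfolding fvs.dependent_def
proof safe
  fix b
  assume "(basis b :: 'b \<Rightarrow>\<^sub>0 'k) \<in> fvs.span (basis ` S - {basis b})"
  moreover have "basis ` S - {basis b} = (basis ` (S - {b}) :: ('b \<Rightarrow>\<^sub>0 'k) set)"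
    by (auto dest: injD[OF inj_basis])
  ultimately have "Poly_Mapping.keys (basis b :: 'b \<Rightarrow>\<^sub>0 'k) \<subseteq> S - {b}"
    by (simp only: span_basis_eq mem_Collect_eq)
  then show False
    by (simp add: basis_def)
qed

lemma dim_span_basis: "fvs.dim (fvs.span (basis ` S) :: ('b \<Rightarrow>\<^sub>0 'k::field) set) = card S"
  by (simp add: fvs.dim_eq_card_independent[OF independent_basis] card_image inj_on_subset[OF inj_basis])

text \<open>
  A partition of the basis according to the value of \<open>\<delta>\<close> decomposes the space it spans: the
  component of a vector at \<open>k\<close> has the coefficients of that vector at the \<open>b\<close> with \<open>\<delta> b = k\<close>.
\<close>

lemma span_basis_direct_sum:
  fixes a :: "'b \<Rightarrow>\<^sub>0 'k::field" and \<delta> :: "'b \<Rightarrow> nat"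
  assumes "a \<in> fvs.span (basis ` S)"
  shows "\<exists>!g. (\<forall>k. g k \<in> fvs.span (basis ` {b \<in> S. \<delta> b = k})) \<and>
    finite {k. g k \<noteq> 0} \<and> a = (\<Sum>k | g k \<noteq> 0. g k)"
proof -
  have lookup_total: "Poly_Mapping.lookup (\<Sum>k | g k \<noteq> 0. g k) b = Poly_Mapping.lookup (g (\<delta> b)) b"
    if g: "\<forall>k. g k \<in> fvs.span (basis ` {b \<in> S. \<delta> b = k})" and fin: "finite {k. g k \<noteq> 0}"
    for g :: "nat \<Rightarrow> 'b \<Rightarrow>\<^sub>0 'k" and b
  proof -
    have "Poly_Mapping.lookup (g k) b = (if k = \<delta> b then Poly_Mapping.lookup (g (\<delta> b)) b else 0)" for k
      using g[rule_format, of k] by (auto simp: span_basis_eq in_keys_iff subset_iff)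
    then have "Poly_Mapping.lookup (\<Sum>k | g k \<noteq> 0. g k) b =
        (\<Sum>k | g k \<noteq> 0. if k = \<delta> b then Poly_Mapping.lookup (g (\<delta> b)) b else 0)"
      unfolding lookup_sum by (intro sum.cong) auto
    then show ?thesis
      using fin by auto
  qed
  define g where "g k = lin_ext (\<lambda>b. if \<delta> b = k then basis b else 0) a" for k
  have lookup_g: "Poly_Mapping.lookup (g k) b = (if \<delta> b = k then Poly_Mapping.lookup a b else 0)" for k b
  proof -
    have "Poly_Mapping.lookup (g k) b =
        (\<Sum>c\<in>Poly_Mapping.keys a. if c = b then (if \<delta> b = k then Poly_Mapping.lookup a b else 0) else 0)"
      unfolding g_def lin_ext_def lookup_sum
      by (rule sum.cong) (auto simp: basis_def lookup_single when_def)
    then show ?thesis by (simp add: in_keys_iff)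
  qed
  have g_comp: "\<forall>k. g k \<in> fvs.span (basis ` {b \<in> S. \<delta> b = k})"
    using assms by (auto simp: span_basis_eq in_keys_iff lookup_g subset_iff split: if_splits)
  have "{k. g k \<noteq> 0} \<subseteq> \<delta> ` Poly_Mapping.keys a"
    by (auto simp: poly_mapping_eq_iff fun_eq_iff lookup_g in_keys_iff split: if_splits)
  then have g_fin: "finite {k. g k \<noteq> 0}"
    by (rule finite_subset) simp
  show ?thesis
  proof (rule ex1I[of _ g])
    have "a = (\<Sum>k | g k \<noteq> 0. g k)"
      by (rule poly_mapping_eqI) (simp add: lookup_total[OF g_comp g_fin] lookup_g)
    with g_comp g_fin show "(\<forall>k. g k \<in> fvs.span (basis ` {b \<in> S. \<delta> b = k})) \<and>
        finite {k. g k \<noteq> 0} \<and> a = (\<Sum>k | g k \<noteq> 0. g k)"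
      by blast
  next
    fix h
    assume h: "(\<forall>k. h k \<in> fvs.span (basis ` {b \<in> S. \<delta> b = k})) \<and>
        finite {k. h k \<noteq> 0} \<and> a = (\<Sum>k | h k \<noteq> 0. h k)"
    have "Poly_Mapping.lookup (h k) b = Poly_Mapping.lookup (g k) b" for k b
    proof (cases "\<delta> b = k")
      case True
      then show ?thesis
        using lookup_total[of h b] h by (simp add: lookup_g)
    next
      case False
      then show ?thesis
        using h by (auto simp: lookup_g span_basis_eq in_keys_iff subset_iff)
    qed
    then show "h = g"
      by (intro ext poly_mapping_eqI)
  qed
qed

section \<open>Compatibility of the product with degrees\<close>

lemma subspace_T_component: "fvs.subspace (T_component n k)"
  by (simp add: T_component_def)

lemma T_component_zero [simp]: "0 \<in> T_component n k"
  by (simp add: subspace_T_component fvs.subspace_0)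

lemma T_component_add: "p \<in> T_component n k \<Longrightarrow> q \<in> T_component n k \<Longrightarrow> p + q \<in> T_component n k"
  by (rule fvs.subspace_add[OF subspace_T_component])

lemma basis_in_T_component:
  "w \<in> lists {0..n} \<Longrightarrow> word_degree w = k \<Longrightarrow> basis w \<in> T_component n k"
  unfolding T_component_def by (rule fvs.span_base) simp

lemma tcons_in_T_component:
  assumes "v \<in> V_component n d" "t \<in> T_component n k"
  shows "tcons v t \<in> T_component n (d + k)"
  unfolding tcons_def
proof (rule lin_ext_in_subspace[OF subspace_T_component assms(1)[unfolded V_component_def]],
    rule lin_ext_in_subspace[OF subspace_T_component assms(2)[unfolded T_component_def]])
  fix x w
  assume "x \<in> {j \<in> {0..n}. letter_degree j = d}" "w \<in> {w \<in> lists {0..n}. word_degree w = k}"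
  then show "basis (x # w) \<in> T_component n (d + k)"
    by (intro basis_in_T_component) (auto simp: word_degree_def)
qed

lemma basis_in_V_component: "j \<le> n \<Longrightarrow> letter_degree j = d \<Longrightarrow> basis j \<in> V_component n d"
  unfolding V_component_def by (rule fvs.span_base) simp

text \<open>
  The degree of a word exceeds the sum of the degrees of its letters by one. This excess is counted
  for both factors but only once for their product, which therefore has degree one less.
\<close>

lemma shuffle_words_degree:
  assumes "u \<in> lists {0..n}" "v \<in> lists {0..n}" "word_degree u + word_degree v = Suc k"
  shows "shuffle_words u v \<in> (T_component n k :: (nat list \<Rightarrow>\<^sub>0 'k::field) set)"
  using assms
proof (induction u v arbitrary: k rule: shuffle_words.induct)
  case (1 v)
  then show ?case by (auto intro!: basis_in_T_component simp: word_degree_def)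
next
  case (2 x u)
  then show ?case
    by (simp only: shuffle_words.simps) (rule basis_in_T_component; simp add: word_degree_def)
next
  case (3 x u y v)
  have x: "basis x \<in> (V_component n (letter_degree x) :: (nat \<Rightarrow>\<^sub>0 'k) set)"
    and y: "basis y \<in> (V_component n (letter_degree y) :: (nat \<Rightarrow>\<^sub>0 'k) set)"
    using 3(3,4) by (auto intro: basis_in_V_component)
  have k: "letter_degree x \<le> k" "letter_degree y \<le> k"
    using 3(5) by (simp_all add: word_degree_def)
  have "shuffle_words u (y # v) \<in> (T_component n (k - letter_degree x) :: (nat list \<Rightarrow>\<^sub>0 'k) set)"
    by (rule 3(1)) (use 3(3-5) k in \<open>auto simp: word_degree_def\<close>)
  moreover have "shuffle_words (x # u) v \<in> (T_component n (k - letter_degree y) :: (nat list \<Rightarrow>\<^sub>0 'k) set)"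
    by (rule 3(2)) (use 3(3-5) k in \<open>auto simp: word_degree_def\<close>)
  ultimately show ?case
    using tcons_in_T_component[OF x] tcons_in_T_component[OF y] k
    by (metis T_component_add le_add_diff_inverse shuffle_words.simps(3))
qed

text \<open>
  A shuffle product has degree one less than the sum of the degrees of its factors; the map \<open>f\<close>, of
  degree one, makes up for this.
\<close>

lemma bullet_words_degree:
  fixes f :: "(nat \<Rightarrow>\<^sub>0 'k::field) \<Rightarrow> (nat \<Rightarrow>\<^sub>0 'k)"
  assumes f: "\<And>d. f ` V_component n d \<subseteq> V_component n (d + 1)"
    and "u \<in> lists {0..n}" "v \<in> lists {0..n}"
  shows "bullet_words f u v \<in> T_component n (word_degree u + word_degree v)"
  using assms(2)
proof (induction u)
  case Nil
  then show ?case by simp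
next
  case (Cons x u)
  let ?d = "letter_degree x" and ?m = "word_degree u + word_degree v"
  have x: "basis x \<in> (V_component n ?d :: (nat \<Rightarrow>\<^sub>0 'k) set)"
    using Cons by (auto intro: basis_in_V_component)
  then have fx: "f (basis x) \<in> V_component n (?d + 1)"
    using f by blast
  have "shuffle_words u v \<in> (T_component n (?m - 1) :: (nat list \<Rightarrow>\<^sub>0 'k) set)"
    using Cons assms(3) by (intro shuffle_words_degree) (auto simp: word_degree_def)
  then have "tcons (f (basis x)) (shuffle_words u v) \<in> T_component n (?d + 1 + (?m - 1))"
    by (rule tcons_in_T_component[OF fx])
  moreover have "tcons (basis x) (bullet_words f u v) \<in> T_component n (?d + ?m)"
    using Cons by (intro tcons_in_T_component x) auto
  moreover have "?d + 1 + (?m - 1) = ?d + ?m" "word_degree (x # u) + word_degree v = ?d + ?m"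
    by (simp_all add: word_degree_def)
  ultimately show ?case
    unfolding bullet_words.simps by (metis T_component_add)
qed

lemma bullet_in_T_component:
  assumes "\<And>d. f ` V_component n d \<subseteq> V_component n (d + 1)"
    and "p \<in> T_component n k" "q \<in> T_component n l"
  shows "bullet f p q \<in> T_component n (k + l)"
  unfolding bullet_def
  by (rule lin_ext_in_subspace[OF subspace_T_component assms(2)[unfolded T_component_def]],
      rule lin_ext_in_subspace[OF subspace_T_component assms(3)[unfolded T_component_def]])
    (use bullet_words_degree[OF assms(1)] in auto)

lemma T_component_subset_T: "T_component n k \<subseteq> T n"
  unfolding T_component_def T_def by (rule fvs.span_mono) auto

lemma bullet_in_T:
  fixes f :: "(nat \<Rightarrow>\<^sub>0 'k::field) \<Rightarrow> (nat \<Rightarrow>\<^sub>0 'k)"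
  assumes "\<And>d. f ` V_component n d \<subseteq> V_component n (d + 1)" "p \<in> T n" "q \<in> T n"
  shows "bullet f p q \<in> T n"
proof -
  have T: "fvs.subspace (T n :: (nat list \<Rightarrow>\<^sub>0 'k) set)"
    by (simp add: T_def)
  show ?thesis
    unfolding bullet_def
    by (rule lin_ext_in_subspace[OF T assms(2)[unfolded T_def]],
        rule lin_ext_in_subspace[OF T assms(3)[unfolded T_def]])
      (use bullet_words_degree[OF assms(1)] T_component_subset_T in blast)
qed

lemma graded_right_pre_lie_algebra_bullet:
  assumes "Vector_Spaces.linear fscale fscale f"
    and "\<And>d. f ` V_component n d \<subseteq> V_component n (d + 1)"
  shows "graded_right_pre_lie_algebra fscale (T n) (bullet f) (T_component n)"
proof unfold_locales
  show "fvs.subspace (T n)"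
    by (simp add: T_def)
  show "\<exists>!g. (\<forall>k. g k \<in> T_component n k) \<and> finite {k. g k \<noteq> 0} \<and> a = (\<Sum>k | g k \<noteq> 0. g k)"
    if "a \<in> T n" for a
    using span_basis_direct_sum[OF that[unfolded T_def], of word_degree]
    by (simp add: T_component_def)
  show "bullet f a b \<in> T n" if "a \<in> T n" "b \<in> T n" for a b
    by (rule bullet_in_T[OF assms(2) that])
  show "bullet f a b \<in> T_component n (k + l)"
    if "a \<in> T_component n k" "b \<in> T_component n l" for a b k l
    by (rule bullet_in_T_component[OF assms(2) that])
qed (simp_all add: bilinear_simps subspace_T_component T_component_subset_T
    bullet_right_pre_lie[OF assms(1)])

section \<open>Counting words\<close>

lemma finite_words_of_degree: "finite {w \<in> lists {0..n}. word_degree w = k}"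
proof (rule finite_subset)
  have "length w \<le> word_degree w" for w
    by (induction w) (auto simp: word_degree_def letter_degree_def)
  then show "{w \<in> lists {0..n}. word_degree w = k} \<subseteq> {w. set w \<subseteq> {0..n} \<and> length w \<le> k}"
    by auto
  show "finite {w. set w \<subseteq> {0..n} \<and> length w \<le> k}"
    by (rule finite_lists_length_le) simp
qed

text \<open>
  A word of degree at least two has a first letter, which is either \<open>0\<close>, of degree two, or one of
  the \<open>n\<close> letters of degree one.
\<close>

lemma card_words_of_degree_rec:
  "card {w \<in> lists {0..n}. word_degree w = Suc (Suc k)} =
    n * card {w \<in> lists {0..n}. word_degree w = Suc k} + card {w \<in> lists {0..n}. word_degree w = k}"
proof -
  let ?W = "\<lambda>k. {w \<in> lists {0..n}. word_degree w = k}"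
  let ?A = "(\<lambda>(j, w). j # w) ` ({1..n} \<times> ?W (Suc k))" and ?B = "(#) 0 ` ?W k"
  have "?W (Suc (Suc k)) = ?A \<union> ?B"
  proof (intro equalityI subsetI)
    fix w
    assume w: "w \<in> ?W (Suc (Suc k))"
    then obtain j w' where "w = j # w'"
      by (cases w) (auto simp: word_degree_def)
    with w show "w \<in> ?A \<union> ?B"
      by (cases "j = 0") (auto simp: word_degree_def letter_degree_def image_iff)
  qed (auto simp: word_degree_def letter_degree_def)
  moreover have "?A \<inter> ?B = {}" by auto
  moreover have "finite ?A" "finite ?B"
    using finite_words_of_degree by auto
  moreover have "card ?A = n * card (?W (Suc k))"
    by (subst card_image) (auto simp: inj_on_def card_cartesian_product)
  moreover have "card ?B = card (?W k)"
    by (rule card_image) (auto simp: inj_on_def)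
  ultimately show ?thesis
    by (simp add: card_Un_disjoint)
qed

lemma words_of_degree_0: "{w \<in> lists {0..n}. word_degree w = 0} = {}"
  by (auto simp: word_degree_def)

lemma words_of_degree_1: "{w \<in> lists {0..n}. word_degree w = Suc 0} = {[]}"
proof -
  have "word_degree w = Suc 0 \<longleftrightarrow> w = []" for w
    by (cases w) (simp_all add: word_degree_def letter_degree_def)
  then show ?thesis by auto
qed

lemma fps_of_linear_recurrence:
  fixes a :: "nat \<Rightarrow> 'a::field"
  assumes "a 0 = 0" "a (Suc 0) = 1" "\<And>k. a (Suc (Suc k)) = of_nat n * a (Suc k) + a k"
  shows "Abs_fps a = fps_X / (1 - of_nat n * fps_X - fps_X ^ 2)"
proof -
  let ?D = "1 - of_nat n * fps_X - fps_X ^ 2 :: 'a fps"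
  have D: "fps_nth ?D 0 = 1"
    by (simp add: power2_eq_square)
  have "Abs_fps a * ?D = Abs_fps a - of_nat n * (fps_X * Abs_fps a) - fps_X * (fps_X * Abs_fps a)"
    by (simp add: algebra_simps power2_eq_square)
  also have "\<dots> = fps_X"
  proof (rule fps_ext)
    fix k
    have n: "of_nat n = fps_const (of_nat n :: 'a)"
      by (simp add: fps_of_nat)
    consider "k = 0" | "k = Suc 0" | m where "k = Suc (Suc m)"
      by (metis nat.exhaust)
    then show "fps_nth (Abs_fps a - of_nat n * (fps_X * Abs_fps a) - fps_X * (fps_X * Abs_fps a)) k = fps_nth fps_X k"
      by cases (simp_all add: n assms)
  qed
  finally have "Abs_fps a * ?D = fps_X" .
  moreover have "?D \<noteq> 0"
    using D by force
  ultimately show ?thesis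
    by (metis nonzero_mult_div_cancel_right)
qed

text \<open>
  The closed form satisfies the same recurrence as the dimensions, because the two numbers
  raised to the power \<open>k\<close> are the roots of \<open>x\<^sup>2 = n x + 1\<close>.
\<close>

lemma fps_binet:
  "fps_X / (1 - of_nat n * fps_X - fps_X ^ 2) =
    Abs_fps (\<lambda>k. 1 / sqrt (real n ^ 2 + 4) *
      (((real n + sqrt (real n ^ 2 + 4)) / 2) ^ k - ((real n - sqrt (real n ^ 2 + 4)) / 2) ^ k))"
proof (rule fps_of_linear_recurrence[symmetric])
  define s where "s = sqrt (real n ^ 2 + 4)"
  have s2: "s * s = real n * real n + 4"
    unfolding s_def by (simp add: power2_eq_square)
  have "s > 0"
    unfolding s_def by (intro real_sqrt_gt_zero add_nonneg_pos) auto
  then show "1 / sqrt (real n ^ 2 + 4) * (((real n + sqrt (real n ^ 2 + 4)) / 2) ^ Suc 0 -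
      ((real n - sqrt (real n ^ 2 + 4)) / 2) ^ Suc 0) = 1"
    unfolding s_def[symmetric] by (simp add: field_simps)
  have root: "((real n + t) / 2) ^ Suc (Suc k) =
      real n * ((real n + t) / 2) ^ Suc k + ((real n + t) / 2) ^ k"
    if t: "t * t = real n * real n + 4" for t k
  proof -
    have "((real n + t) / 2) * ((real n + t) / 2) = real n * ((real n + t) / 2) + 1"
      using t by (simp add: field_simps)
    then have "((real n + t) / 2) * ((real n + t) / 2) * ((real n + t) / 2) ^ k =
        (real n * ((real n + t) / 2) + 1) * ((real n + t) / 2) ^ k"
      by (rule arg_cong)
    then show ?thesis
      by (simp only: power_Suc distrib_right mult.assoc mult_1)
  qed
  fix k
  show "1 / sqrt (real n ^ 2 + 4) * (((real n + sqrt (real n ^ 2 + 4)) / 2) ^ Suc (Suc k) -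
        ((real n - sqrt (real n ^ 2 + 4)) / 2) ^ Suc (Suc k)) =
      of_nat n * (1 / sqrt (real n ^ 2 + 4) * (((real n + sqrt (real n ^ 2 + 4)) / 2) ^ Suc k -
        ((real n - sqrt (real n ^ 2 + 4)) / 2) ^ Suc k)) +
      1 / sqrt (real n ^ 2 + 4) * (((real n + sqrt (real n ^ 2 + 4)) / 2) ^ k -
        ((real n - sqrt (real n ^ 2 + 4)) / 2) ^ k)"
    unfolding s_def[symmetric] using root[of s k] root[of "- s" k] s2
    by (simp only: minus_mult_minus add_uminus_conv_diff) (simp add: algebra_simps del: power_Suc)
qed simp

section \<open>The gradation and its formal series\<close>

theorem theorem40:
  fixes n i :: nat
    and f :: "(nat \<Rightarrow>\<^sub>0 'k::field_char_0) \<Rightarrow> (nat \<Rightarrow>\<^sub>0 'k)"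
  assumes "n \<ge> 1" and "1 \<le> i" and "i \<le> n"
    and "Vector_Spaces.linear fscale fscale f"
    and "\<And>j. j \<le> n \<Longrightarrow> f (basis j) = (if i = j then basis 0 else 0)"
  shows "(\<forall>d. f ` V_component n d \<subseteq> V_component n (d + 1)) \<and>
    graded_right_pre_lie_algebra fscale (T n) (bullet f) (T_component n) \<and>
    (\<forall>k. \<exists>B. finite B \<and> fvs.span B = (T_component n k :: (nat list \<Rightarrow>\<^sub>0 'k) set)) \<and>
    Abs_fps (\<lambda>k. real (fvs.dim (T_component n k :: (nat list \<Rightarrow>\<^sub>0 'k) set))) =
      fps_X / (1 - of_nat n * fps_X - fps_X ^ 2) \<and>
    fps_X / (1 - of_nat n * fps_X - fps_X ^ 2) =
      Abs_fps (\<lambda>k. 1 / sqrt (real n ^ 2 + 4) *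
        (((real n + sqrt (real n ^ 2 + 4)) / 2) ^ k -
         ((real n - sqrt (real n ^ 2 + 4)) / 2) ^ k))"
proof (intro conjI allI)
  interpret f: Vector_Spaces.linear fscale fscale f by fact
  show deg: "f ` V_component n d \<subseteq> V_component n (d + 1)" for d
  proof -
    have "f (basis j) \<in> V_component n (letter_degree j + 1)" if "j \<le> n" for j
    proof (cases "i = j")
      case True
      then show ?thesis
        using assms(2) that by (auto simp: assms(5) letter_degree_def intro: basis_in_V_component)
    next
      case False
      then show ?thesis
        using that by (simp add: assms(5) V_component_def fvs.span_zero)
    qed
    then have "f ` basis ` {j \<in> {0..n}. letter_degree j = d} \<subseteq> V_component n (d + 1)"
      by auto
    then have "fvs.span (f ` basis ` {j \<in> {0..n}. letter_degree j = d}) \<subseteq> V_component n (d + 1)"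
      by (rule fvs.span_minimal) (simp add: V_component_def)
    then show ?thesis
      by (simp add: V_component_def f.span_image)
  qed
  show "graded_right_pre_lie_algebra fscale (T n) (bullet f) (T_component n)"
    by (rule graded_right_pre_lie_algebra_bullet) (fact assms(4), fact deg)
  show "\<exists>B. finite B \<and> fvs.span B = (T_component n k :: (nat list \<Rightarrow>\<^sub>0 'k) set)" for k
    unfolding T_component_def using finite_words_of_degree by blast
  show "Abs_fps (\<lambda>k. real (fvs.dim (T_component n k :: (nat list \<Rightarrow>\<^sub>0 'k) set))) =
      fps_X / (1 - of_nat n * fps_X - fps_X ^ 2)"
    unfolding T_component_def dim_span_basis
    by (rule fps_of_linear_recurrence)
      (simp_all only: card_words_of_degree_rec words_of_degree_0 words_of_degree_1, simp_all)
qed (rule fps_binet)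

end
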